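(* For every $\gamma\in[0,1]$, $$\mathfrak D_{s,\lambda,\gamma}(P,Q)=(1-\gamma)L_s^\star(P,Q)-\gamma\,\Delta_s(P,Q)=\frac{1-\gamma}{2}W_s(P,Q)-\frac{1+\gamma}{2}\Delta_s(P,Q).$$ The infima over $\mathcal C(P,Q)$ defining $W_s(P,Q)$, $L_s^\star(P,Q)$ and $\mathfrak D_{s,\lambda,\gamma}(P,Q)$ are attained. Moreover, for $\gamma<1$, the couplings that attain the infimum defining $\mathfrak D_{s,\lambda,\gamma}(P,Q)$ are exactly those that attain the infimum defining $W_s(P,Q)$.
   Context: Let $D\subseteq\mathbb R^d$ be a nonempty Borel set; $P,Q$ are Borel probability measures supported on $D$ (i.e. $P(D)=Q(D)=1$) with finite first moments. $\mathcal C(P,Q)$ is the set of couplings of $P$ and $Q$ (first marginal $P$, second marginal $Q$), and $t_+:=\max\{t,0\}$. Let $(\Theta,\mathscr A,\lambda)$ be a finite measure space and $s:\Theta\times\mathbb R^d\to\mathbb R$ jointly measurable; write $s_\theta(x):=s(\theta,x)$. Standing assumptions: each $s_\theta$ is coordinatewise nondecreasing, $\int_\Theta|s_\theta(0)|\,\lambda(d\theta)<\infty$, and for some finite constant $\overline L_s$, $\int_\Theta|s_\theta(x)-s_\theta(y)|\,\lambda(d\theta)\le\overline L_s\|x-y\|_1$ for all $x,y\in\mathbb R^d$. Define $S(x):=\int_\Theta s_\theta(x)\,\lambda(d\theta)$, $\ d_s(x,y):=\int_\Theta|s_\theta(x)-s_\theta(y)|\,\lambda(d\theta)$, $\ \ell_s(x,y):=\int_\Theta(s_\theta(x)-s_\theta(y))_+\,\lambda(d\theta)$,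 $$W_s(P,Q):=\inf_{\kappa\in\mathcal C(P,Q)}\int_{D\times D}d_s(x,y)\,\kappa(dx,dy),\qquad \Delta_s(P,Q):=\int_D S\,dQ-\int_D S\,dP,$$ $$L_s^\star(P,Q):=\inf_{\kappa\in\mathcal C(P,Q)}\int_{D\times D}\ell_s(x,y)\,\kappa(dx,dy),$$ $$\mathfrak D_{s,\lambda,\gamma}(P,Q):=\inf_{\kappa\in\mathcal C(P,Q)}\int_{D\times D}\{\ell_s(x,y)-\gamma\,\ell_s(y,x)\}\,\kappa(dx,dy).$$ *)

theory Defs
  imports "HOL-Probability.Probability"
begin

definition norm_l1 :: "real ^ 'd \<Rightarrow> real" where
  "norm_l1 x = (\<Sum>i\<in>UNIV. \<bar>x $ i\<bar>)"

definition couplings :: "'a measure \<Rightarrow> 'b measure \<Rightarrow> ('a \<times> 'b) measure set" where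
  "couplings P Q = {\<kappa>. sets \<kappa> = sets (P \<Otimes>\<^sub>M Q) \<and> distr \<kappa> P fst = P \<and> distr \<kappa> Q snd = Q}"

definition transport_cost :: "'a set \<Rightarrow> ('a \<Rightarrow> 'a \<Rightarrow> real) \<Rightarrow> ('a \<times> 'a) measure \<Rightarrow> real" where
  "transport_cost D c \<kappa> = (LINT z:D \<times> D|\<kappa>. c (fst z) (snd z))"

definition optimal_cost ::
    "'a set \<Rightarrow> ('a \<Rightarrow> 'a \<Rightarrow> real) \<Rightarrow> 'a measure \<Rightarrow> 'a measure \<Rightarrow> real" where
  "optimal_cost D c P Q = (INF \<kappa>\<in>couplings P Q. transport_cost D c \<kappa>)"

text \<open>The infimum of a set of reals that is not bounded below is unspecified, so boundedness
  is part of what it means to attain the infimum.\<close>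

definition attains_optimal_cost ::
    "'a set \<Rightarrow> ('a \<Rightarrow> 'a \<Rightarrow> real) \<Rightarrow> 'a measure \<Rightarrow> 'a measure \<Rightarrow> ('a \<times> 'a) measure \<Rightarrow> bool" where
  "attains_optimal_cost D c P Q \<kappa> \<longleftrightarrow>
     \<kappa> \<in> couplings P Q \<and> bdd_below (transport_cost D c ` couplings P Q) \<and>
     transport_cost D c \<kappa> = optimal_cost D c P Q"

definition agg_score :: "'t measure \<Rightarrow> ('t \<Rightarrow> 'a \<Rightarrow> real) \<Rightarrow> 'a \<Rightarrow> real" where
  "agg_score \<Lambda> s x = (LINT \<theta>|\<Lambda>. s \<theta> x)"

definition score_dist :: "'t measure \<Rightarrow> ('t \<Rightarrow> 'a \<Rightarrow> real) \<Rightarrow> 'a \<Rightarrow> 'a \<Rightarrow> real" where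
  "score_dist \<Lambda> s x y = (LINT \<theta>|\<Lambda>. \<bar>s \<theta> x - s \<theta> y\<bar>)"

definition score_loss :: "'t measure \<Rightarrow> ('t \<Rightarrow> 'a \<Rightarrow> real) \<Rightarrow> 'a \<Rightarrow> 'a \<Rightarrow> real" where
  "score_loss \<Lambda> s x y = (LINT \<theta>|\<Lambda>. max (s \<theta> x - s \<theta> y) 0)"

definition net_loss :: "'t measure \<Rightarrow> ('t \<Rightarrow> 'a \<Rightarrow> real) \<Rightarrow> real \<Rightarrow> 'a \<Rightarrow> 'a \<Rightarrow> real" where
  "net_loss \<Lambda> s \<gamma> x y = score_loss \<Lambda> s x y - \<gamma> * score_loss \<Lambda> s y x"

definition W_score ::
    "'a set \<Rightarrow> 't measure \<Rightarrow> ('t \<Rightarrow> 'a \<Rightarrow> real) \<Rightarrow> 'a measure \<Rightarrow> 'a measure \<Rightarrow> real" where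
  "W_score D \<Lambda> s P Q = optimal_cost D (score_dist \<Lambda> s) P Q"

definition Delta_score ::
    "'a set \<Rightarrow> 't measure \<Rightarrow> ('t \<Rightarrow> 'a \<Rightarrow> real) \<Rightarrow> 'a measure \<Rightarrow> 'a measure \<Rightarrow> real" where
  "Delta_score D \<Lambda> s P Q = (LINT x:D|Q. agg_score \<Lambda> s x) - (LINT x:D|P. agg_score \<Lambda> s x)"

definition L_star ::
    "'a set \<Rightarrow> 't measure \<Rightarrow> ('t \<Rightarrow> 'a \<Rightarrow> real) \<Rightarrow> 'a measure \<Rightarrow> 'a measure \<Rightarrow> real" where
  "L_star D \<Lambda> s P Q = optimal_cost D (score_loss \<Lambda> s) P Q"

definition D_score ::
    "'a set \<Rightarrow> 't measure \<Rightarrow> ('t \<Rightarrow> 'a \<Rightarrow> real) \<Rightarrow> real \<Rightarrow> 'a measure \<Rightarrow> 'a measure \<Rightarrow> real" where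
  "D_score D \<Lambda> s \<gamma> P Q = optimal_cost D (net_loss \<Lambda> s \<gamma>) P Q"

end

theory Submission
  imports Defs
begin

text \<open>Since max(a, 0) = (|a| + a) / 2, the integrand of the net loss equals
  (1 - \<gamma>) / 2 * d(x, y) + (1 + \<gamma>) / 2 * (S x - S y), and the integral of S x - S y
  against a coupling depends only on the marginals. Hence all three costs are increasing affine
  functions of the cost for d on the set of couplings (for \<gamma> = 1, the net loss is constant there),
  and everything reduces to the existence of an optimal coupling for d, which is a nonnegative
  continuous cost. Existence holds because the set of couplings is compact: a cluster point of a
  minimising sequence, taken setwise, is countably additive on an algebra generated by
  rectangles, as the fixed marginals force compact inner regularity uniformly over all couplings.\<close>

section \<open>Compact approximation of sets and staircase approximation of functions\<close>

text \<open>Inner regularity of Borel probability measures, phrased with the measure of the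
  difference because this quantity transfers to couplings: a cylinder has the measure of its base
  under the corresponding marginal.\<close>

lemma compact_inner_approximation:
  fixes M :: "'a::{second_countable_topology, complete_space} measure"
  assumes "prob_space M" "sets M = sets borel" "A \<in> sets borel" "\<epsilon> > 0"
  obtains K where "K \<subseteq> A" "compact K" "measure M (A - K) \<le> \<epsilon>"
proof -
  interpret prob_space M by fact
  have "emeasure M A = (SUP K \<in> {K. K \<subseteq> A \<and> compact K}. emeasure M K)"
    using assms by (intro inner_regular) auto
  then have "\<exists>K\<in>{K. K \<subseteq> A \<and> compact K}. emeasure M A < emeasure M K + ennreal \<epsilon>"
    using emeasure_finite[of A] by (intro SUP_approx_ennreal \<open>\<epsilon> > 0\<close>) auto
  then obtain K where K: "K \<subseteq> A" "compact K" "emeasure M A < emeasure M K + ennreal \<epsilon>" by auto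
  moreover have "measure M (A - K) = measure M A - measure M K"
    using K assms by (intro finite_measure_Diff) (auto intro: borel_compact)
  moreover have "measure M A < measure M K + \<epsilon>"
    using K(3) \<open>\<epsilon> > 0\<close>
    by (simp add: emeasure_eq_measure ennreal_plus[symmetric] ennreal_less_iff del: ennreal_plus)
  ultimately show ?thesis using that by force
qed

text \<open>A Riemann sum for the layer-cake formula: composed with a lower semicontinuous cost it is a
  finite combination of indicators of open sets.\<close>

definition level_count :: "nat \<Rightarrow> real \<Rightarrow> real" where
  "level_count N t = (\<Sum>j\<in>{1..N\<^sup>2}. indicator {real j / N <..} t / N)"

lemma level_count_eq: "level_count N t = real (card {j\<in>{1..N\<^sup>2}. real j / N < t}) / N"
  unfolding level_count_def sum_divide_distrib[symmetric]
  by (simp add: indicator_def sum.If_cases Int_def)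

lemma level_count_le:
  assumes "0 \<le> t"
  shows "level_count N t \<le> t"
\<comment> \<open>For \<open>N = 0\<close> the index set \<open>{1..0}\<close> is empty, so the
  count is 0.\<close>
proof (cases "N = 0")
  case False
  have "{j\<in>{1..N\<^sup>2}. real j / N < t} \<subseteq> {1..nat \<lfloor>N * t\<rfloor>}"
  proof safe
    fix j assume "j \<in> {1..N\<^sup>2}" "real j / N < t"
    then have "real j < N * t" using False by (simp add: pos_divide_less_eq mult.commute)
    then show "j \<in> {1..nat \<lfloor>N * t\<rfloor>}"
      using \<open>j \<in> {1..N\<^sup>2}\<close> by (simp add: le_nat_floor)
  qed
  then have "card {j\<in>{1..N\<^sup>2}. real j / N < t} \<le> nat \<lfloor>N * t\<rfloor>"
    by (metis card_atLeastAtMost card_mono diff_Suc_1 finite_atLeastAtMost)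
  moreover have "real (nat \<lfloor>N * t\<rfloor>) \<le> N * t" using assms by simp
  ultimately have "real (card {j\<in>{1..N\<^sup>2}. real j / N < t}) \<le> N * t" by linarith
  then show ?thesis
    using False by (simp add: level_count_eq pos_divide_le_eq mult.commute)
qed (simp add: level_count_def assms)

text \<open>The levels stop at height \<open>N\<close>, hence the truncation of \<open>t\<close>;
  below that height the staircase lags behind by at most one step of size
  \<open>1 / N\<close>.\<close>

lemma level_count_ge:
  assumes "N > 0" "0 \<le> t"
  shows "min t N \<le> level_count N t + 1 / N"
proof -
  define u where "u = min t N"
  have u: "0 \<le> u" "u \<le> t" "u \<le> N" using assms by (auto simp: u_def)
  \<comment> \<open>The largest integer strictly below \<open>N * u\<close> is
    \<open>\<lceil>N * u\<rceil> - 1\<close>; the floor would be off by one when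
    \<open>N * u\<close> is an integer, because levels are counted with a strict inequality. The
    truncation \<open>u \<le> N\<close> keeps these indices among the available levels.\<close>
  have "j \<in> {j\<in>{1..N\<^sup>2}. real j / N < t}" if "j \<in> {1..nat (\<lceil>N * u\<rceil> - 1)}" for j
  proof -
    have "int j < \<lceil>N * u\<rceil>" using that by auto
    then have "real j < N * u" by (simp add: less_ceiling_iff)
    moreover have "N * u \<le> real N * real N" by (rule mult_left_mono[OF u(3)]) simp
    moreover have "N * u \<le> N * t" by (rule mult_left_mono[OF u(2)]) simp
    ultimately have "real j < real N * real N" "real j < N * t" by linarith+
    then have "j < N * N" "real j / N < t"
      using \<open>N > 0\<close> by (simp_all only: of_nat_mult[symmetric] of_nat_less_iff)
        (simp add: pos_divide_less_eq mult.commute)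
    then show ?thesis using that by (simp add: power2_eq_square)
  qed
  then have "card {1..nat (\<lceil>N * u\<rceil> - 1)} \<le> card {j\<in>{1..N\<^sup>2}. real j / N < t}"
    by (intro card_mono) auto
  moreover have "N * u \<le> real (nat (\<lceil>N * u\<rceil> - 1)) + 1" by linarith
  ultimately have "N * u \<le> real (card {j\<in>{1..N\<^sup>2}. real j / N < t}) + 1" by simp
  then show ?thesis unfolding u_def[symmetric]
    using assms by (simp add: level_count_eq pos_le_divide_eq mult.commute flip: add_divide_distrib)
qed

section \<open>Couplings of two Borel probability measures on Polish spaces\<close>

text \<open>Polish spaces provide both inner regularity by compact sets and the identification of
  the product sigma-algebra with the Borel sets of the product, so that topology and
  \<open>couplings\<close> fit together.\<close>

locale borel_prob_pair = P: prob_space P + Q: prob_space Q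
  for P :: "'a::polish_space measure" and Q :: "'b::polish_space measure" +
  assumes sets_P [measurable_cong]: "sets P = sets borel"
    and sets_Q [measurable_cong]: "sets Q = sets borel"
begin

lemma sets_pair_borel: "sets (P \<Otimes>\<^sub>M Q) = sets borel"
  unfolding borel_prod[symmetric] by (rule sets_pair_measure_cong[OF sets_P sets_Q])

lemma sets_coupling: "\<kappa> \<in> couplings P Q \<Longrightarrow> sets \<kappa> = sets (borel :: ('a \<times> 'b) measure)"
  by (simp add: couplings_def sets_pair_borel)

lemma space_coupling: "\<kappa> \<in> couplings P Q \<Longrightarrow> space \<kappa> = UNIV"
  using sets_eq_imp_space_eq[OF sets_coupling] by simp

lemma measurable_fst_coupling: "\<kappa> \<in> couplings P Q \<Longrightarrow> fst \<in> measurable \<kappa> P"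
  and measurable_snd_coupling: "\<kappa> \<in> couplings P Q \<Longrightarrow> snd \<in> measurable \<kappa> Q"
  by (auto simp: couplings_def cong: measurable_cong_sets)

lemma distr_fst_coupling: "\<kappa> \<in> couplings P Q \<Longrightarrow> distr \<kappa> P fst = P"
  and distr_snd_coupling: "\<kappa> \<in> couplings P Q \<Longrightarrow> distr \<kappa> Q snd = Q"
  by (auto simp: couplings_def)

text \<open>The definition of \<open>couplings\<close> does not mention total mass; it is inherited
  from \<open>P\<close> through the first marginal.\<close>

lemma prob_space_coupling: "\<kappa> \<in> couplings P Q \<Longrightarrow> prob_space \<kappa>"
  using prob_space_distrD[OF measurable_fst_coupling] distr_fst_coupling P.prob_space_axioms
  by metis

lemma measure_coupling_fst:
  assumes "\<kappa> \<in> couplings P Q" "A \<in> sets borel"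
  shows "measure \<kappa> (A \<times> UNIV) = measure P A"
proof -
  have "measure P A = measure (distr \<kappa> P fst) A"
    by (simp add: distr_fst_coupling assms)
  also have "\<dots> = measure \<kappa> (fst -` A \<inter> space \<kappa>)"
    using assms by (intro measure_distr measurable_fst_coupling) (auto simp: sets_P)
  also have "fst -` A \<inter> space \<kappa> = A \<times> UNIV"
    by (auto simp: space_coupling assms)
  finally show ?thesis ..
qed

lemma measure_coupling_snd:
  assumes "\<kappa> \<in> couplings P Q" "B \<in> sets borel"
  shows "measure \<kappa> (UNIV \<times> B) = measure Q B"
proof -
  have "measure Q B = measure (distr \<kappa> Q snd) B"
    by (simp add: distr_snd_coupling assms)
  also have "\<dots> = measure \<kappa> (snd -` B \<inter> space \<kappa>)"
    using assms by (intro measure_distr measurable_snd_coupling) (auto simp: sets_Q)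
  also have "snd -` B \<inter> space \<kappa> = UNIV \<times> B"
    by (auto simp: space_coupling assms)
  finally show ?thesis ..
qed

text \<open>Marginals are tested on cylinders, which is how they are accessible for the product
  measure and for a measure obtained as a setwise limit.\<close>

lemma couplingI:
  assumes sets: "sets \<kappa> = sets (borel :: ('a \<times> 'b) measure)"
    and fst: "\<And>A. A \<in> sets borel \<Longrightarrow> emeasure \<kappa> (A \<times> UNIV) = emeasure P A"
    and snd: "\<And>B. B \<in> sets borel \<Longrightarrow> emeasure \<kappa> (UNIV \<times> B) = emeasure Q B"
  shows "\<kappa> \<in> couplings P Q"
proof -
  have sets': "sets \<kappa> = sets (P \<Otimes>\<^sub>M Q)"
    by (simp add: sets sets_pair_borel)
  have space: "space \<kappa> = UNIV"
    using sets_eq_imp_space_eq[OF sets] by simp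
  have [measurable]: "fst \<in> measurable \<kappa> P" "snd \<in> measurable \<kappa> Q"
    by (simp_all add: sets' cong: measurable_cong_sets)
  have "distr \<kappa> P fst = P"
  proof (rule measure_eqI)
    fix A assume "A \<in> sets (distr \<kappa> P fst)"
    moreover have "fst -` A \<inter> space \<kappa> = A \<times> UNIV" by (auto simp: space)
    ultimately show "emeasure (distr \<kappa> P fst) A = emeasure P A"
      by (simp add: emeasure_distr fst sets_P)
  qed simp
  moreover have "distr \<kappa> Q snd = Q"
  proof (rule measure_eqI)
    fix A assume "A \<in> sets (distr \<kappa> Q snd)"
    moreover have "snd -` A \<inter> space \<kappa> = UNIV \<times> A" by (auto simp: space)
    ultimately show "emeasure (distr \<kappa> Q snd) A = emeasure Q A"
      by (simp add: emeasure_distr snd sets_Q)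
  qed simp
  ultimately show ?thesis by (simp add: couplings_def sets')
qed

text \<open>Makes \<open>couplings P Q\<close> nonempty, so that a minimising sequence can be
  chosen.\<close>

lemma pair_measure_coupling: "P \<Otimes>\<^sub>M Q \<in> couplings P Q"
proof (rule couplingI)
  show "sets (P \<Otimes>\<^sub>M Q) = sets borel" by (rule sets_pair_borel)
next
  fix A :: "'a set" assume "A \<in> sets borel"
  then show "emeasure (P \<Otimes>\<^sub>M Q) (A \<times> UNIV) = emeasure P A"
    using Q.emeasure_space_1 Q.emeasure_pair_measure_Times[of A P UNIV]
      sets_eq_imp_space_eq[OF sets_Q] by (simp add: sets_P sets_Q)
next
  fix B :: "'b set" assume "B \<in> sets borel"
  then show "emeasure (P \<Otimes>\<^sub>M Q) (UNIV \<times> B) = emeasure Q B"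
    using P.emeasure_space_1 Q.emeasure_pair_measure_Times[of UNIV P B]
      sets_eq_imp_space_eq[OF sets_P] by (simp add: sets_P sets_Q)
qed

section \<open>Inner regularity uniform over all couplings\<close>

text \<open>The order of quantifiers matters: limits are taken along varying couplings, so
  \<open>K\<close> must not depend on \<open>\<kappa>\<close>.\<close>

definition unif_inner_regular :: "('a \<times> 'b) set \<Rightarrow> bool" where
  "unif_inner_regular E \<longleftrightarrow> E \<in> sets borel \<and>
     (\<forall>\<epsilon>>0. \<exists>K\<subseteq>E. compact K \<and> (\<forall>\<kappa>\<in>couplings P Q. measure \<kappa> (E - K) \<le> \<epsilon>))"

lemma unif_inner_regularE:
  assumes "unif_inner_regular E" "\<epsilon> > 0"
  obtains K where "K \<subseteq> E" "compact K" "\<And>\<kappa>. \<kappa> \<in> couplings P Q \<Longrightarrow> measure \<kappa> (E - K) \<le> \<epsilon>"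
  using assms unfolding unif_inner_regular_def by metis

text \<open>Uniform inner regularity passes to finite unions and intersections, but not evidently to
  complements. Asking for it on both sides makes closure under complement automatic, and De Morgan
  gives an algebra.\<close>

definition regular_algebra :: "('a \<times> 'b) set set" where
  "regular_algebra = {E. unif_inner_regular E \<and> unif_inner_regular (- E)}"

lemma coupling_measure_subset_Un_le:
  assumes \<kappa>: "\<kappa> \<in> couplings P Q" and "X \<subseteq> Y \<union> Z" "Y \<in> sets borel" "Z \<in> sets borel"
    and "measure \<kappa> Y \<le> \<epsilon>/2" "measure \<kappa> Z \<le> \<epsilon>/2"
  shows "measure \<kappa> X \<le> \<epsilon>"
proof -
  interpret \<kappa>: prob_space \<kappa> by (rule prob_space_coupling[OF \<kappa>])
  have "measure \<kappa> X \<le> measure \<kappa> (Y \<union> Z)"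
    using assms by (intro \<kappa>.finite_measure_mono) (auto simp: sets_coupling)
  also have "\<dots> \<le> measure \<kappa> Y + measure \<kappa> Z"
    using assms by (intro measure_Un_le) (auto simp: sets_coupling)
  finally show ?thesis using assms by linarith
qed

text \<open>For both operations, what \<open>op A B\<close> has outside \<open>op K L\<close> lies
  in \<open>(A - K) \<union> (B - L)\<close>, so one argument with two halves of
  \<open>\<epsilon>\<close> settles union and intersection together.\<close>

lemma unif_inner_regular_combine:
  assumes A: "unif_inner_regular A" and B: "unif_inner_regular B" and op: "op = (\<union>) \<or> op = (\<inter>)"
  shows "unif_inner_regular (op A B)"
  unfolding unif_inner_regular_def
proof (intro conjI allI impI)
  show "op A B \<in> sets borel" using A B op by (auto simp: unif_inner_regular_def)
next
  fix \<epsilon> :: real assume "\<epsilon> > 0"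
  then have "\<epsilon>/2 > 0" by simp
  obtain K where K: "K \<subseteq> A" "compact K" "\<And>\<kappa>. \<kappa> \<in> couplings P Q \<Longrightarrow> measure \<kappa> (A - K) \<le> \<epsilon>/2"
    using unif_inner_regularE[OF A \<open>\<epsilon>/2 > 0\<close>] by blast
  obtain L where L: "L \<subseteq> B" "compact L" "\<And>\<kappa>. \<kappa> \<in> couplings P Q \<Longrightarrow> measure \<kappa> (B - L) \<le> \<epsilon>/2"
    using unif_inner_regularE[OF B \<open>\<epsilon>/2 > 0\<close>] by blast
  have sets: "A - K \<in> sets borel" "B - L \<in> sets borel"
    using A B K(2) L(2) by (auto simp: unif_inner_regular_def intro: borel_compact)
  have diff: "op A B - op K L \<subseteq> (A - K) \<union> (B - L)" using op by auto
  have "measure \<kappa> (op A B - op K L) \<le> \<epsilon>" if "\<kappa> \<in> couplings P Q" for \<kappa>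
    by (rule coupling_measure_subset_Un_le[OF that diff sets K(3)[OF that] L(3)[OF that]])
  moreover have "op K L \<subseteq> op A B" "compact (op K L)"
    using K(1,2) L(1,2) op by (auto intro: compact_Int)
  ultimately show "\<exists>M\<subseteq>op A B. compact M \<and> (\<forall>\<kappa>\<in>couplings P Q. measure \<kappa> (op A B - M) \<le> \<epsilon>)"
    by blast
qed

lemmas unif_inner_regular_Un = unif_inner_regular_combine[where op = "(\<union>)", simplified]
  and unif_inner_regular_Int = unif_inner_regular_combine[where op = "(\<inter>)", simplified]

text \<open>Here the fixed marginals produce uniformity: the part of \<open>A \<times> B\<close>
  outside \<open>K \<times> L\<close> is covered by two cylinders, whose measures depend on
  \<open>P\<close> and \<open>Q\<close> alone.\<close>

lemma unif_inner_regular_Times: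
  assumes A: "A \<in> sets borel" and B: "B \<in> sets borel"
  shows "unif_inner_regular (A \<times> B)"
  unfolding unif_inner_regular_def
proof (intro conjI allI impI)
  show "A \<times> B \<in> sets borel" using A B by (simp add: borel_prod[symmetric])
next
  fix \<epsilon> :: real assume "\<epsilon> > 0"
  then have \<epsilon>: "\<epsilon>/2 > 0" by simp
  obtain K where K: "K \<subseteq> A" "compact K" "measure P (A - K) \<le> \<epsilon>/2"
    using compact_inner_approximation[OF P.prob_space_axioms sets_P A \<epsilon>] by blast
  obtain L where L: "L \<subseteq> B" "compact L" "measure Q (B - L) \<le> \<epsilon>/2"
    using compact_inner_approximation[OF Q.prob_space_axioms sets_Q B \<epsilon>] by blast
  have sets: "A - K \<in> sets borel" "B - L \<in> sets borel"
    using K L A B by (auto intro: borel_compact)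
  then have sets': "(A - K) \<times> (UNIV :: 'b set) \<in> sets borel" "(UNIV :: 'a set) \<times> (B - L) \<in> sets borel"
    by (simp_all add: borel_prod[symmetric])
  have diff: "A \<times> B - K \<times> L \<subseteq> (A - K) \<times> UNIV \<union> UNIV \<times> (B - L)" by auto
  have "measure \<kappa> (A \<times> B - K \<times> L) \<le> \<epsilon>" if "\<kappa> \<in> couplings P Q" for \<kappa>
    by (rule coupling_measure_subset_Un_le[OF that diff sets'])
      (simp_all only: measure_coupling_fst[OF that sets(1)] measure_coupling_snd[OF that sets(2)]
        K(3) L(3))
  moreover have "K \<times> L \<subseteq> A \<times> B" "compact (K \<times> L)"
    using K(1,2) L(1,2) by (auto intro: compact_Times)
  ultimately show "\<exists>M\<subseteq>A \<times> B. compact M \<and> (\<forall>\<kappa>\<in>couplings P Q. measure \<kappa> (A \<times> B - M) \<le> \<epsilon>)"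
    by blast
qed

lemma Times_in_regular_algebra:
  assumes "A \<in> sets borel" "B \<in> sets borel"
  shows "A \<times> B \<in> regular_algebra"
proof -
  have eq: "- (A \<times> B) = (- A) \<times> UNIV \<union> UNIV \<times> (- B)" by auto
  have "unif_inner_regular (- (A \<times> B))"
    unfolding eq using assms
    by (intro unif_inner_regular_Un unif_inner_regular_Times) auto
  then show ?thesis
    using assms by (simp add: regular_algebra_def unif_inner_regular_Times)
qed

lemma regular_algebra_sets: "E \<in> regular_algebra \<Longrightarrow> E \<in> sets borel"
  by (simp add: regular_algebra_def unif_inner_regular_def)

lemma algebra_regular_algebra: "algebra UNIV regular_algebra"
  unfolding algebra_iff_Un
  using Times_in_regular_algebra[of "{}" "{}"]
  by (auto simp: regular_algebra_def unif_inner_regular_Un unif_inner_regular_Int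
      Compl_eq_Diff_UNIV[symmetric])

lemma sigma_sets_regular_algebra: "sigma_sets UNIV regular_algebra = sets borel"
proof
  show "sigma_sets UNIV regular_algebra \<subseteq> sets borel"
    using sets.sigma_sets_subset[of regular_algebra "borel :: ('a \<times> 'b) measure"]
    by (auto intro: regular_algebra_sets)
  have "sets (borel :: ('a \<times> 'b) measure) =
      sigma_sets UNIV {A \<times> B | A B. A \<in> sets borel \<and> B \<in> sets borel}"
    by (simp add: borel_prod[symmetric] sets_pair_measure)
  also have "\<dots> \<subseteq> sigma_sets UNIV regular_algebra"
    by (intro sigma_sets_mono') (auto intro: Times_in_regular_algebra)
  finally show "sets borel \<subseteq> sigma_sets UNIV regular_algebra" .
qed

section \<open>Compactness of the set of couplings\<close>

text \<open>Compact \<open>K i \<subseteq> E i\<close> have empty intersection, hence so do finitely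
  many of them. From then on \<open>E m\<close> is covered by finitely many of the remainders
  \<open>E i - K i\<close>, which are small under every coupling at once.\<close>

lemma regular_algebra_empty_continuous:
  assumes E: "range E \<subseteq> regular_algebra" "decseq E" "(\<Inter>i. E i) = {}" and "\<epsilon> > 0"
  obtains n where "\<And>m \<kappa>. m \<ge> n \<Longrightarrow> \<kappa> \<in> couplings P Q \<Longrightarrow> measure \<kappa> (E m) \<le> \<epsilon>"
proof -
  \<comment> \<open>Geometric weights of total sum \<open>\<epsilon>\<close>, so that any finite
    number of remainders stays within the tolerance.\<close>
  define \<delta> where "\<delta> i = \<epsilon> / 2 * (1/2) ^ i" for i :: nat
  have \<delta>: "\<delta> i > 0" for i using \<open>\<epsilon> > 0\<close> by (simp add: \<delta>_def)
  have "unif_inner_regular (E i)" for i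
    using E(1) by (auto simp: regular_algebra_def)
  then have "\<exists>K\<subseteq>E i. compact K \<and> (\<forall>\<kappa>\<in>couplings P Q. measure \<kappa> (E i - K) \<le> \<delta> i)" for i
    using \<delta>[of i] by (simp add: unif_inner_regular_def)
  then obtain K where K: "\<And>i. K i \<subseteq> E i" "\<And>i. compact (K i)"
    and K': "\<And>i \<kappa>. \<kappa> \<in> couplings P Q \<Longrightarrow> measure \<kappa> (E i - K i) \<le> \<delta> i" by metis
  \<comment> \<open>\<open>K 0\<close> is the compact set to which the finite intersection property
    is applied; the other \<open>K i\<close> enter as closed sets.\<close>
  have "K 0 \<inter> (\<Inter>i\<in>UNIV. K i) = {}" using K(1) E(3) by fastforce
  then obtain I where I: "finite I" "K 0 \<inter> (\<Inter>i\<in>I. K i) = {}"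
    using compact_imp_fip_image[of "K 0" UNIV K] K(2) compact_imp_closed by (metis subset_UNIV)
  define n where "n = Max (insert 0 I)"
  have n: "insert 0 I \<subseteq> {..n}" using I(1) by (auto simp: n_def)
  show ?thesis
  proof
    fix m \<kappa> assume m: "m \<ge> n" and \<kappa>: "\<kappa> \<in> couplings P Q"
    interpret \<kappa>: prob_space \<kappa> by (rule prob_space_coupling[OF \<kappa>])
    have sets: "E i - K i \<in> sets \<kappa>" for i
      using E(1) K(2) unfolding sets_coupling[OF \<kappa>]
      by (intro sets.Diff borel_compact regular_algebra_sets) auto
    \<comment> \<open>A point of \<open>E m\<close> lies in every earlier \<open>E i\<close>, since
      the sequence decreases, but misses some \<open>K i\<close> with
      \<open>i \<le> n\<close>.\<close>
    have "E m \<subseteq> (\<Union>i\<in>{..n}. E i - K i)"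
    proof
      fix z assume z: "z \<in> E m"
      have "z \<in> E i" if "i \<le> n" for i
        using z decseqD[OF E(2), of i m] m that by auto
      moreover have "\<exists>i\<in>insert 0 I. z \<notin> K i" using I(2) by auto
      ultimately show "z \<in> (\<Union>i\<in>{..n}. E i - K i)" using n by blast
    qed
    then have "measure \<kappa> (E m) \<le> measure \<kappa> (\<Union>i\<in>{..n}. E i - K i)"
      using sets by (intro \<kappa>.finite_measure_mono) auto
    also have "\<dots> \<le> (\<Sum>i\<le>n. measure \<kappa> (E i - K i))"
      using sets by (intro measure_UNION_le) auto
    also have "\<dots> \<le> (\<Sum>i\<le>n. \<delta> i)" by (intro sum_mono K' \<kappa>)
    also have "\<dots> = \<epsilon> / 2 * (\<Sum>i\<le>n. (1/2) ^ i)" by (simp add: \<delta>_def sum_distrib_left)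
    also have "\<dots> = \<epsilon> * (1 - (1/2) ^ Suc n)"
      by (simp add: sum_gp0)
    also have "\<dots> \<le> \<epsilon>"
      using \<open>\<epsilon> > 0\<close> by (intro mult_left_le) auto
    finally show "measure \<kappa> (E m) \<le> \<epsilon>" .
  qed
qed

text \<open>The limit comes from Tychonoff's theorem for set functions on all sets, and is therefore
  only a limit along some filter finer than the sequential one.\<close>

lemma coupling_cluster_point:
  assumes \<kappa>: "\<And>n. \<kappa> n \<in> couplings P Q"
  obtains \<mu> F where "\<mu> \<in> couplings P Q" "F \<noteq> bot" "F \<le> sequentially"
    "\<forall>E\<in>regular_algebra. ((\<lambda>n. measure (\<kappa> n) E) \<longlongrightarrow> measure \<mu> E) F"
proof -
  \<comment> \<open>On a nonmeasurable \<open>E\<close> the value is the default 0, so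
    \<open>?f n\<close> is a point of the cube \<open>?C\<close> without restricting the
    domain.\<close>
  let ?f = "\<lambda>n E. measure (\<kappa> n) E"
  let ?C = "(\<Pi>\<^sub>E E\<in>UNIV. {0..1}) :: (('a \<times> 'b) set \<Rightarrow> real) set"
  have prob: "prob_space (\<kappa> n)" for n by (rule prob_space_coupling[OF \<kappa>])
  have sets: "E \<in> sets (\<kappa> n)" if "E \<in> regular_algebra" for E n
    using that by (simp add: sets_coupling[OF \<kappa>] regular_algebra_sets)
  have "compact ?C"
    using compactin_PiE[of "\<lambda>_. euclidean" UNIV "\<lambda>_::('a \<times> 'b) set. {0..1::real}"]
    by (simp add: euclidean_product_topology)
  moreover have "eventually (\<lambda>g. g \<in> ?C) (filtermap ?f sequentially)"
    by (auto simp: eventually_filtermap PiE_def extensional_def prob_space.prob_le_1[OF prob])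
  ultimately obtain l where l: "inf (nhds l) (filtermap ?f sequentially) \<noteq> bot"
    unfolding compact_filter by (meson filtermap_bot_iff sequentially_bot)
  \<comment> \<open>\<open>l\<close> is a cluster point, so its neighbourhoods meet the image
    filter. Pulling them back to the indices gives a filter finer than the sequential one along
    which \<open>?f\<close> converges to \<open>l\<close> coordinatewise.\<close>
  define F where "F = inf (filtercomap ?f (nhds l)) sequentially"
  have "F \<noteq> bot"
  proof
    assume "F = bot"
    then have "eventually (\<lambda>_. False) F" by simp
    then obtain X Y where "eventually X (nhds l)" "eventually Y sequentially" "\<And>n. X (?f n) \<Longrightarrow> Y n \<Longrightarrow> False"
      unfolding F_def eventually_inf eventually_filtercomap by metis
    then have "eventually (\<lambda>n. \<not> X (?f n)) sequentially" "eventually X (nhds l)"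
      by (blast intro: eventually_mono)+
    then have "eventually (\<lambda>_. False) (inf (nhds l) (filtermap ?f sequentially))"
      unfolding eventually_inf eventually_filtermap
      by - (rule exI[of _ X], rule exI[of _ "\<lambda>g. \<not> X g"], auto)
    with l show False by (simp add: eventually_False)
  qed
  have "F \<le> sequentially" by (simp add: F_def)
  have f_lim: "filterlim ?f (nhds l) F"
    unfolding F_def by (rule filterlim_mono[OF filterlim_filtercomap]) auto
  have coord: "continuous_on UNIV (\<lambda>g :: ('a \<times> 'b) set \<Rightarrow> real. g E)" for E
    by (rule continuous_on_product_coordinates)
  have lim: "((\<lambda>n. measure (\<kappa> n) E) \<longlongrightarrow> l E) F" for E
    by (rule continuous_on_tendsto_compose[OF coord[of E] f_lim]) simp_all
  have l_ge: "l E \<ge> 0" for E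
    by (rule tendsto_lowerbound[OF lim]) (auto simp: \<open>F \<noteq> bot\<close>)
  \<comment> \<open>A value shared by all \<open>\<kappa> n\<close> survives in the limit; this
    yields the empty set here and both marginals below.\<close>
  have l_eq: "l E = a" if "\<And>n. measure (\<kappa> n) E = a" for E a
    using tendsto_unique[OF \<open>F \<noteq> bot\<close> lim[of E], of a] that by simp
  interpret R: algebra UNIV regular_algebra by (rule algebra_regular_algebra)
  have "\<exists>\<mu>. (\<forall>E\<in>regular_algebra. \<mu> E = ennreal (l E)) \<and>
      measure_space UNIV (sigma_sets UNIV regular_algebra) \<mu>"
  \<comment> \<open>On an algebra, a finite additive set function that is continuous at the empty
    set extends to a measure. Additivity passes to the limit coordinatewise; continuity needs
    uniformity over couplings.\<close>
  proof (rule R.caratheodory_empty_continuous)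
    show "positive regular_algebra (\<lambda>E. ennreal (l E))"
      using l_eq[of "{}" 0] by (simp add: positive_def)
    show "additive regular_algebra (\<lambda>E. ennreal (l E))"
      unfolding additive_def
    proof (intro ballI impI)
      fix A B assume AB: "A \<in> regular_algebra" "B \<in> regular_algebra" "A \<inter> B = {}"
      have "measure (\<kappa> n) (A \<union> B) = measure (\<kappa> n) A + measure (\<kappa> n) B" for n
      proof -
        interpret prob_space "\<kappa> n" by (rule prob)
        show ?thesis using AB by (intro finite_measure_Union sets)
      qed
      then have "l (A \<union> B) = l A + l B"
        using tendsto_unique[OF \<open>F \<noteq> bot\<close> lim[of "A \<union> B"] , of "l A + l B"]
          tendsto_add[OF lim[of A] lim[of B]] by simp
      then show "ennreal (l (A \<union> B)) = ennreal (l A) + ennreal (l B)"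
        by (simp add: l_ge)
    qed
    show "(\<lambda>i. ennreal (l (E i))) \<longlonglongrightarrow> 0"
      if E: "range E \<subseteq> regular_algebra" "decseq E" "(\<Inter>i. E i) = {}" for E :: "nat \<Rightarrow> ('a \<times> 'b) set"
    proof -
      have "(\<lambda>i. l (E i)) \<longlonglongrightarrow> 0"
      proof (rule LIMSEQ_I)
        fix r :: real assume "r > 0"
        then have "r/2 > 0" by simp
        then obtain n where n: "\<And>m \<kappa>. m \<ge> n \<Longrightarrow> \<kappa> \<in> couplings P Q \<Longrightarrow> measure \<kappa> (E m) \<le> r/2"
          using regular_algebra_empty_continuous[OF E] by blast
        \<comment> \<open>The index \<open>n\<close> works for all couplings, so the bound holds for
          every term before passing to the limit; no exchange of limits occurs.\<close>
        have "l (E m) \<le> r/2" if "m \<ge> n" for m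
          by (rule tendsto_upperbound[OF lim always_eventually \<open>F \<noteq> bot\<close>]) (intro allI n that \<kappa>)
        with \<open>r > 0\<close> show "\<exists>n. \<forall>m\<ge>n. norm (l (E m) - 0) < r"
          by (intro exI[of _ n]) (force simp: l_ge)
      qed
      then show ?thesis using tendsto_ennrealI by fastforce
    qed
  qed simp
  then obtain \<nu> where \<nu>: "\<And>E. E \<in> regular_algebra \<Longrightarrow> \<nu> E = ennreal (l E)"
    and ms: "measure_space UNIV (sets borel) \<nu>"
    by (auto simp: sigma_sets_regular_algebra)
  define \<mu> where "\<mu> = measure_of UNIV (sets borel) \<nu>"
  have sets_\<mu>: "sets \<mu> = sets borel"
    using sets.sigma_sets_eq[of "borel :: ('a \<times> 'b) measure"] by (simp add: \<mu>_def)
  have emeasure_\<mu>: "emeasure \<mu> E = ennreal (l E)" if "E \<in> regular_algebra" for E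
    unfolding \<mu>_def using ms \<nu>[OF that] regular_algebra_sets[OF that]
    by (subst emeasure_measure_of_sigma) (auto simp: measure_space_def)
  show ?thesis
  proof
    show "\<mu> \<in> couplings P Q"
    proof (rule couplingI)
      show "sets \<mu> = sets borel" by (rule sets_\<mu>)
      show "emeasure \<mu> (A \<times> UNIV) = emeasure P A" if "A \<in> sets borel" for A
        using l_eq[of "A \<times> UNIV" "measure P A"] that \<kappa>
        by (simp add: emeasure_\<mu> Times_in_regular_algebra measure_coupling_fst P.emeasure_eq_measure)
      show "emeasure \<mu> (UNIV \<times> B) = emeasure Q B" if "B \<in> sets borel" for B
        using l_eq[of "UNIV \<times> B" "measure Q B"] that \<kappa>
        by (simp add: emeasure_\<mu> Times_in_regular_algebra measure_coupling_snd Q.emeasure_eq_measure)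
    qed
    show "\<forall>E\<in>regular_algebra. ((\<lambda>n. measure (\<kappa> n) E) \<longlongrightarrow> measure \<mu> E) F"
      using lim by (simp add: measure_def[of \<mu>] emeasure_\<mu> l_ge)
  qed fact+
qed

section \<open>Lower semicontinuity of the cost and existence of a minimiser\<close>

text \<open>Setwise convergence is known on the algebra only, so open sets are approximated from
  inside: a compact subset carrying almost all the mass is covered by finitely many open rectangles
  contained in \<open>U\<close>. The set \<open>E\<close> may depend on \<open>\<mu>\<close>, as it
  is chosen for the limit coupling.\<close>

lemma open_approx_regular_algebra:
  assumes \<mu>: "\<mu> \<in> couplings P Q" and "open U" "\<delta> > 0"
  obtains E where "E \<in> regular_algebra" "E \<subseteq> U" "measure \<mu> U \<le> measure \<mu> E + \<delta>"
proof -
  interpret \<mu>: prob_space \<mu> by (rule prob_space_coupling[OF \<mu>])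
  interpret R: algebra UNIV regular_algebra by (rule algebra_regular_algebra)
  obtain K where K: "K \<subseteq> U" "compact K" "measure \<mu> (U - K) \<le> \<delta>"
    using compact_inner_approximation[OF \<mu>.prob_space_axioms sets_coupling[OF \<mu>] borel_open[OF \<open>open U\<close>] \<open>\<delta> > 0\<close>] by blast
  have "\<exists>A B. open A \<and> open B \<and> z \<in> A \<times> B \<and> A \<times> B \<subseteq> U" if "z \<in> K" for z
    using open_prod_elim[OF \<open>open U\<close>, of z] K(1) that by blast
  then obtain A B where AB: "\<And>z. z \<in> K \<Longrightarrow> open (A z) \<and> open (B z) \<and> z \<in> A z \<times> B z \<and> A z \<times> B z \<subseteq> U"
    by metis
  obtain C where C: "C \<subseteq> K" "finite C" "K \<subseteq> (\<Union>z\<in>C. A z \<times> B z)"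
  proof (rule compactE_image[OF K(2), of K "\<lambda>z. A z \<times> B z"])
    show "open (A z \<times> B z)" if "z \<in> K" for z using AB[OF that] by (simp add: open_Times)
    show "K \<subseteq> (\<Union>z\<in>K. A z \<times> B z)" using AB by blast
  qed
  define E where "E = (\<Union>z\<in>C. A z \<times> B z)"
  have E: "E \<in> regular_algebra"
    unfolding E_def using C AB by (intro R.finite_UN Times_in_regular_algebra) auto
  have sets: "U \<in> sets \<mu>" "E \<in> sets \<mu>" "K \<in> sets \<mu>"
    using \<open>open U\<close> E K by (auto simp: sets_coupling[OF \<mu>] regular_algebra_sets borel_compact)
  have "measure \<mu> U \<le> measure \<mu> (E \<union> (U - K))"
    using C sets by (intro \<mu>.finite_measure_mono) (auto simp: E_def)
  also have "\<dots> \<le> measure \<mu> E + measure \<mu> (U - K)"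
    using sets by (intro measure_Un_le) auto
  finally show ?thesis using that[of E] E K C AB by (force simp: E_def)
qed

text \<open>Shrinking the level sets to \<open>E j\<close> only lowers the staircase, which already
  lies below \<open>c\<close>. The sets are arbitrary because those chosen for the limit coupling
  are tested against each term of the sequence.\<close>

lemma level_sum_le:
  fixes c :: "'a \<times> 'b \<Rightarrow> real"
  assumes \<kappa>: "\<kappa> \<in> couplings P Q" and c: "\<And>z. 0 \<le> c z"
    and E: "\<And>j. j \<in> {1..N\<^sup>2} \<Longrightarrow> E j \<in> sets borel" "\<And>j. j \<in> {1..N\<^sup>2} \<Longrightarrow> E j \<subseteq> {z. real j / N < c z}"
  shows "ennreal (\<Sum>j\<in>{1..N\<^sup>2}. measure \<kappa> (E j) / N) \<le> (\<integral>\<^sup>+z. ennreal (c z) \<partial>\<kappa>)"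
proof -
  interpret \<kappa>: prob_space \<kappa> by (rule prob_space_coupling[OF \<kappa>])
  have [measurable]: "j \<in> {1..N\<^sup>2} \<Longrightarrow> E j \<in> sets \<kappa>" for j
    using E by (simp add: sets_coupling[OF \<kappa>])
  have int: "integrable \<kappa> (\<lambda>z. indicator (E j) z / N)" if "j \<in> {1..N\<^sup>2}" for j
    using that by (intro integrable_divide integrable_real_indicator) (auto simp: \<kappa>.emeasure_eq_measure)
  have "(\<Sum>j\<in>{1..N\<^sup>2}. measure \<kappa> (E j) / N) = (\<integral>z. (\<Sum>j\<in>{1..N\<^sup>2}. indicator (E j) z / N) \<partial>\<kappa>)"
    using int by (simp add: Bochner_Integration.integral_sum \<kappa>.emeasure_eq_measure)
  also have "ennreal \<dots> = (\<integral>\<^sup>+z. (\<Sum>j\<in>{1..N\<^sup>2}. indicator (E j) z / N) \<partial>\<kappa>)"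
    using int by (intro nn_integral_eq_integral[symmetric] Bochner_Integration.integrable_sum)
      (auto intro!: sum_nonneg)
  also have "\<dots> \<le> (\<integral>\<^sup>+z. ennreal (c z) \<partial>\<kappa>)"
  proof (intro nn_integral_mono ennreal_leI)
    fix z
    have "(\<Sum>j\<in>{1..N\<^sup>2}. indicator (E j) z / N) \<le> level_count N (c z)"
      unfolding level_count_def using E(2)
      by (intro sum_mono divide_right_mono) (auto simp: indicator_def)
    also have "\<dots> \<le> c z" by (intro level_count_le c)
    finally show "(\<Sum>j\<in>{1..N\<^sup>2}. indicator (E j) z / N) \<le> c z" .
  qed
  finally show ?thesis .
qed

text \<open>The direct method: the cost at a cluster point of a minimising sequence is at most the
  infimum. It suffices to bound each truncated cost by a finite sum over sets of the algebra, where
  the measures converge. Costs are extended nonnegative integrals, so no integrability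
  enters.\<close>

theorem optimal_coupling_exists:
  fixes c :: "'a \<times> 'b \<Rightarrow> real"
  assumes c: "\<And>z. 0 \<le> c z" and lsc: "\<And>t. open {z. t < c z}"
  obtains \<mu> where "\<mu> \<in> couplings P Q"
    "\<And>\<kappa>. \<kappa> \<in> couplings P Q \<Longrightarrow> (\<integral>\<^sup>+z. ennreal (c z) \<partial>\<mu>) \<le> (\<integral>\<^sup>+z. ennreal (c z) \<partial>\<kappa>)"
proof -
  let ?C = "\<lambda>\<kappa>. \<integral>\<^sup>+z. ennreal (c z) \<partial>\<kappa>"
  define I where "I = (INF \<kappa>\<in>couplings P Q. ?C \<kappa>)"
  have c_borel: "c \<in> borel_measurable borel"
    unfolding borel_measurable_iff_greater using lsc by simp
  obtain f :: "nat \<Rightarrow> ennreal" where f: "decseq f" "range f \<subseteq> ?C ` couplings P Q" "I = (INF i. f i)"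
    using ennreal_Inf_countable_INF[of "?C ` couplings P Q"] pair_measure_coupling
    unfolding I_def by blast
  have "\<exists>\<kappa>. \<kappa> \<in> couplings P Q \<and> f n = ?C \<kappa>" for n
    using subsetD[OF f(2), of "f n"] by auto
  then obtain \<kappa> where \<kappa>: "\<And>n. \<kappa> n \<in> couplings P Q" and f_eq: "\<And>n. f n = ?C (\<kappa> n)"
    by metis
  have lim: "(\<lambda>n. ?C (\<kappa> n)) \<longlonglongrightarrow> I"
    using LIMSEQ_INF[OF f(1)] unfolding f(3) by (simp only: f_eq[symmetric])
  obtain \<mu> F where \<mu>: "\<mu> \<in> couplings P Q" and F: "F \<noteq> bot" "F \<le> sequentially"
    and lim_E: "\<forall>E\<in>regular_algebra. ((\<lambda>n. measure (\<kappa> n) E) \<longlongrightarrow> measure \<mu> E) F"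
    by (rule coupling_cluster_point[of \<kappa>, OF \<kappa>])
  interpret \<mu>: prob_space \<mu> by (rule prob_space_coupling[OF \<mu>])
  have c_meas [measurable]: "c \<in> borel_measurable \<mu>"
    using c_borel by (simp add: sets_coupling[OF \<mu>] cong: measurable_cong_sets)
  have bound: "(\<integral>\<^sup>+z. ennreal (min (c z) N) \<partial>\<mu>) \<le> I + ennreal (2 / N)" if N: "N > 0" for N :: nat
  proof -
    define U where "U j = {z. real j / N < c z}" for j :: nat
    have U: "open (U j)" for j unfolding U_def by (rule lsc)
    then have [measurable]: "U j \<in> sets \<mu>" for j by (simp add: sets_coupling[OF \<mu>])
    \<comment> \<open>There are \<open>N\<^sup>2\<close> levels of weight \<open>1 / N\<close>; a
      tolerance of \<open>1 / N\<^sup>2\<close> for each adds up to \<open>1 / N\<close>. With the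
      \<open>1 / N\<close> from \<open>level_count_ge\<close> this makes the \<open>2 / N\<close> in
      the bound.\<close>
    have "\<exists>E\<in>regular_algebra. E \<subseteq> U j \<and> measure \<mu> (U j) \<le> measure \<mu> E + 1 / N\<^sup>2" for j
      using open_approx_regular_algebra[OF \<mu> U[of j], of "1 / N\<^sup>2"] N by force
    then obtain E where E: "\<And>j. E j \<in> regular_algebra" "\<And>j. E j \<subseteq> U j"
      and \<mu>E: "\<And>j. measure \<mu> (U j) \<le> measure \<mu> (E j) + 1 / N\<^sup>2" by metis
    have lim_sum: "((\<lambda>n. ennreal (\<Sum>j\<in>{1..N\<^sup>2}. measure (\<kappa> n) (E j) / N))
        \<longlongrightarrow> ennreal (\<Sum>j\<in>{1..N\<^sup>2}. measure \<mu> (E j) / N)) F"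
      using N by (intro tendsto_ennrealI tendsto_sum tendsto_divide lim_E[rule_format] E tendsto_const) auto
    have lim_C: "((\<lambda>n. ?C (\<kappa> n)) \<longlongrightarrow> I) F" by (rule tendsto_mono[OF F(2) lim])
    have sum_le: "ennreal (\<Sum>j\<in>{1..N\<^sup>2}. measure (\<kappa> n) (E j) / N) \<le> ?C (\<kappa> n)" for n
      using E(2) by (intro level_sum_le \<kappa> c regular_algebra_sets E(1)) (simp add: U_def)
    have E_le: "ennreal (\<Sum>j\<in>{1..N\<^sup>2}. measure \<mu> (E j) / N) \<le> I"
      by (rule tendsto_le[OF F(1) lim_C lim_sum always_eventually]) (intro allI sum_le)
    have int: "integrable \<mu> (\<lambda>z. indicator (U j) z / N)" for j
      by (intro integrable_divide integrable_real_indicator) (auto simp: \<mu>.emeasure_eq_measure)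
    have level: "level_count N (c z) = (\<Sum>j\<in>{1..N\<^sup>2}. indicator (U j) z / N)" for z
      by (simp add: level_count_def U_def indicator_def)
    have int': "integrable \<mu> (\<lambda>z. level_count N (c z))"
      unfolding level by (intro Bochner_Integration.integrable_sum int)
    have "(\<integral>\<^sup>+z. ennreal (min (c z) N) \<partial>\<mu>) \<le> (\<integral>\<^sup>+z. ennreal (level_count N (c z) + 1 / N) \<partial>\<mu>)"
      by (intro nn_integral_mono ennreal_leI level_count_ge N c)
    also have "\<dots> = ennreal (\<integral>z. level_count N (c z) + 1 / N \<partial>\<mu>)"
      using int' by (intro nn_integral_eq_integral) (auto simp: level intro!: add_nonneg_nonneg sum_nonneg)
    also have "(\<integral>z. level_count N (c z) + 1 / N \<partial>\<mu>) = (\<Sum>j\<in>{1..N\<^sup>2}. measure \<mu> (U j) / N) + 1 / N"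
    proof -
      have "(\<integral>z. level_count N (c z) + 1 / N \<partial>\<mu>) = (\<integral>z. level_count N (c z) \<partial>\<mu>) + 1 / N"
        using int' by (subst Bochner_Integration.integral_add) (auto simp: \<mu>.prob_space)
      also have "(\<integral>z. level_count N (c z) \<partial>\<mu>) = (\<Sum>j\<in>{1..N\<^sup>2}. measure \<mu> (U j) / N)"
        unfolding level using int by (simp add: Bochner_Integration.integral_sum)
      finally show ?thesis .
    qed
    also have "\<dots> \<le> (\<Sum>j\<in>{1..N\<^sup>2}. (measure \<mu> (E j) + 1 / N\<^sup>2) / N) + 1 / N"
      by (intro add_right_mono sum_mono divide_right_mono \<mu>E) auto
    also have "\<dots> = (\<Sum>j\<in>{1..N\<^sup>2}. measure \<mu> (E j) / N) + 2 / N"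
      using N by (simp add: add_divide_distrib sum.distrib)
    finally have "(\<integral>\<^sup>+z. ennreal (min (c z) N) \<partial>\<mu>) \<le> ennreal ((\<Sum>j\<in>{1..N\<^sup>2}. measure \<mu> (E j) / N) + 2 / N)"
      by (simp add: ennreal_leI)
    also have "\<dots> = ennreal (\<Sum>j\<in>{1..N\<^sup>2}. measure \<mu> (E j) / N) + ennreal (2 / N)"
      by (intro ennreal_plus sum_nonneg) auto
    also have "\<dots> \<le> I + ennreal (2 / N)" by (intro add_right_mono E_le)
    finally show ?thesis .
  qed
  \<comment> \<open>Let \<open>N\<close> tend to infinity: the truncations increase to
    \<open>c\<close>, so monotone convergence applies on the left, while the error on the right
    vanishes.\<close>
  have "?C \<mu> \<le> I"
  proof (rule LIMSEQ_le)
    show "(\<lambda>N. \<integral>\<^sup>+z. ennreal (min (c z) N) \<partial>\<mu>) \<longlonglongrightarrow> ?C \<mu>"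
    proof (rule nn_integral_LIMSEQ)
      show "incseq (\<lambda>N z. ennreal (min (c z) (real N)))"
        by (auto simp: incseq_def le_fun_def intro!: ennreal_leI)
      fix z
      obtain M :: nat where "c z \<le> M" using real_arch_simple by blast
      then have "eventually (\<lambda>N. ennreal (min (c z) (real N)) = ennreal (c z)) sequentially"
        by (auto simp: eventually_sequentially min_def intro!: exI[of _ M])
      then show "(\<lambda>N. ennreal (min (c z) (real N))) \<longlonglongrightarrow> ennreal (c z)"
        by (rule tendsto_eventually)
    qed auto
    have "(\<lambda>N. I + ennreal (2 / N)) \<longlonglongrightarrow> I + ennreal 0"
      by (intro tendsto_add tendsto_ennrealI tendsto_const lim_const_over_n)
    then show "(\<lambda>N. I + ennreal (2 / N)) \<longlonglongrightarrow> I" by simp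
    show "\<exists>n. \<forall>N\<ge>n. (\<integral>\<^sup>+z. ennreal (min (c z) (real N)) \<partial>\<mu>) \<le> I + ennreal (2 / real N)"
      using bound by (intro exI[of _ 1]) auto
  qed
  then have "?C \<mu> \<le> ?C \<kappa>'" if "\<kappa>' \<in> couplings P Q" for \<kappa>'
    unfolding I_def using that by (meson INF_lower order_trans)
  with \<mu> that show ?thesis by blast
qed

section \<open>Integrals of functions of one coordinate\<close>

lemma integral_coupling_fst:
  fixes h :: "'a \<Rightarrow> real"
  assumes \<kappa>: "\<kappa> \<in> couplings P Q" and h: "h \<in> borel_measurable borel"
  shows "(\<integral>z. h (fst z) \<partial>\<kappa>) = (\<integral>x. h x \<partial>P)"
  using integral_distr[OF measurable_fst_coupling[OF \<kappa>], of h] h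
  by (simp add: distr_fst_coupling[OF \<kappa>] sets_P cong: measurable_cong_sets)

lemma integral_coupling_snd:
  fixes h :: "'b \<Rightarrow> real"
  assumes \<kappa>: "\<kappa> \<in> couplings P Q" and h: "h \<in> borel_measurable borel"
  shows "(\<integral>z. h (snd z) \<partial>\<kappa>) = (\<integral>x. h x \<partial>Q)"
  using integral_distr[OF measurable_snd_coupling[OF \<kappa>], of h] h
  by (simp add: distr_snd_coupling[OF \<kappa>] sets_Q cong: measurable_cong_sets)

lemma integrable_coupling_fst:
  fixes h :: "'a \<Rightarrow> real"
  assumes \<kappa>: "\<kappa> \<in> couplings P Q" and h: "integrable P h"
  shows "integrable \<kappa> (\<lambda>z. h (fst z))"
  using integrable_distr[OF measurable_fst_coupling[OF \<kappa>], of h] h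
  by (simp add: distr_fst_coupling[OF \<kappa>])

lemma integrable_coupling_snd:
  fixes h :: "'b \<Rightarrow> real"
  assumes \<kappa>: "\<kappa> \<in> couplings P Q" and h: "integrable Q h"
  shows "integrable \<kappa> (\<lambda>z. h (snd z))"
  using integrable_distr[OF measurable_snd_coupling[OF \<kappa>], of h] h
  by (simp add: distr_snd_coupling[OF \<kappa>])

end

section \<open>Attainment, scores and continuity\<close>

text \<open>A minimiser is itself a lower bound, so boundedness below comes with it. In this form,
  attainment is visibly preserved by increasing affine changes of the cost.\<close>

lemma attains_optimal_cost_iff:
  "attains_optimal_cost D c P Q \<kappa> \<longleftrightarrow>
    \<kappa> \<in> couplings P Q \<and> (\<forall>\<kappa>'\<in>couplings P Q. transport_cost D c \<kappa> \<le> transport_cost D c \<kappa>')"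
proof
  assume "attains_optimal_cost D c P Q \<kappa>"
  then show "\<kappa> \<in> couplings P Q \<and> (\<forall>\<kappa>'\<in>couplings P Q. transport_cost D c \<kappa> \<le> transport_cost D c \<kappa>')"
    by (auto simp: attains_optimal_cost_def optimal_cost_def intro: cINF_lower)
next
  assume \<kappa>: "\<kappa> \<in> couplings P Q \<and> (\<forall>\<kappa>'\<in>couplings P Q. transport_cost D c \<kappa> \<le> transport_cost D c \<kappa>')"
  then have "optimal_cost D c P Q = transport_cost D c \<kappa>"
    unfolding optimal_cost_def by (intro cInf_eq_minimum) auto
  moreover have "bdd_below (transport_cost D c ` couplings P Q)"
    using \<kappa> by (auto simp: bdd_below_def)
  ultimately show "attains_optimal_cost D c P Q \<kappa>"
    using \<kappa> by (simp add: attains_optimal_cost_def)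
qed

lemma
  assumes "\<And>x. integrable \<Lambda> (\<lambda>\<theta>. s \<theta> x)"
  shows score_loss_eq: "score_loss \<Lambda> s x y = (score_dist \<Lambda> s x y + agg_score \<Lambda> s x - agg_score \<Lambda> s y) / 2"
    and score_dist_triangle: "score_dist \<Lambda> s x y \<le> score_dist \<Lambda> s x z + score_dist \<Lambda> s z y"
    and agg_score_diff_le: "\<bar>agg_score \<Lambda> s x - agg_score \<Lambda> s y\<bar> \<le> score_dist \<Lambda> s x y"
proof -
  have "score_loss \<Lambda> s x y = (LINT \<theta>|\<Lambda>. (\<bar>s \<theta> x - s \<theta> y\<bar> + s \<theta> x - s \<theta> y) / 2)"
    unfolding score_loss_def by (intro Bochner_Integration.integral_cong) (auto simp: max_def abs_if)
  then show "score_loss \<Lambda> s x y = (score_dist \<Lambda> s x y + agg_score \<Lambda> s x - agg_score \<Lambda> s y) / 2"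
    unfolding score_dist_def agg_score_def using assms by simp
  have "score_dist \<Lambda> s x y \<le> (LINT \<theta>|\<Lambda>. \<bar>s \<theta> x - s \<theta> z\<bar> + \<bar>s \<theta> z - s \<theta> y\<bar>)"
    unfolding score_dist_def using assms
    by (intro integral_mono integrable_abs Bochner_Integration.integrable_add
        Bochner_Integration.integrable_diff) auto
  then show "score_dist \<Lambda> s x y \<le> score_dist \<Lambda> s x z + score_dist \<Lambda> s z y"
    unfolding score_dist_def using assms by simp
  show "\<bar>agg_score \<Lambda> s x - agg_score \<Lambda> s y\<bar> \<le> score_dist \<Lambda> s x y"
    using integral_abs_bound[of \<Lambda> "\<lambda>\<theta>. s \<theta> x - s \<theta> y"] assms
    by (simp add: agg_score_def score_dist_def)
qed

lemma score_dist_commute: "score_dist \<Lambda> s x y = score_dist \<Lambda> s y x"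
  by (simp add: score_dist_def abs_minus_commute)

lemma score_dist_nonneg: "0 \<le> score_dist \<Lambda> s x y"
  by (simp add: score_dist_def)

lemma continuous_norm_l1: "continuous_on A norm_l1"
  unfolding norm_l1_def by (intro continuous_intros)

lemma norm_l1_nonneg: "0 \<le> norm_l1 x"
  by (simp add: norm_l1_def sum_nonneg)

lemma norm_l1_diff_le: "norm_l1 (x - y) \<le> norm_l1 x + norm_l1 y"
  unfolding norm_l1_def sum.distrib[symmetric] by (intro sum_mono) auto

text \<open>A squeeze as \<open>x\<close> tends to \<open>y\<close>. With \<open>g\<close> built
  from \<open>norm_l1\<close>, it turns the Lipschitz bound into continuity, hence Borel
  measurability, of \<open>agg_score\<close> and \<open>score_dist\<close>.\<close>

lemma continuous_on_dominated_increments: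
  fixes f :: "'a::topological_space \<Rightarrow> real" and g :: "'a \<Rightarrow> 'a \<Rightarrow> real"
  assumes "\<And>x y. \<bar>f x - f y\<bar> \<le> g x y" "\<And>y. continuous_on UNIV (\<lambda>x. g x y)" "\<And>y. g y y = 0"
  shows "continuous_on UNIV f"
  unfolding continuous_on_def
proof
  fix y
  have "((\<lambda>x. g x y) \<longlongrightarrow> 0) (at y)"
    using assms(2)[of y] assms(3)[of y] unfolding continuous_on_def by (metis UNIV_I)
  then have "((\<lambda>x. f x - f y) \<longlongrightarrow> 0) (at y)"
    by (rule Lim_null_comparison[rotated]) (simp add: assms(1))
  then show "(f \<longlongrightarrow> f y) (at y within UNIV)"
    by (simp add: LIM_zero_cancel)
qed

text \<open>Couplings live on the whole product space; this removes the restriction to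
  \<open>D\<close> or \<open>D \<times> D\<close>, which carry full mass.\<close>

lemma set_integral_AE_eq:
  fixes f :: "'a \<Rightarrow> real"
  assumes "AE x in M. x \<in> A" "A \<in> sets M" "f \<in> borel_measurable M"
  shows "(LINT x:A|M. f x) = (LINT x|M. f x)"
  unfolding set_lebesgue_integral_def using assms by (intro integral_cong_AE) auto

section \<open>Reduction of the three transport problems to the score distance\<close>

theorem theorem2p2:
  fixes D :: "(real ^ 'd) set"
    and P Q :: "(real ^ 'd) measure"
    and \<Lambda> :: "'t measure"
    and s :: "'t \<Rightarrow> real ^ 'd \<Rightarrow> real"
    and L \<gamma> :: real
  assumes "D \<in> sets borel" and "D \<noteq> {}"
    and "prob_space P" and "sets P = sets borel" and "measure P D = 1" and "integrable P norm_l1"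
    and "prob_space Q" and "sets Q = sets borel" and "measure Q D = 1" and "integrable Q norm_l1"
    and "finite_measure \<Lambda>"
    and "(\<lambda>(\<theta>, x). s \<theta> x) \<in> borel_measurable (\<Lambda> \<Otimes>\<^sub>M borel)"
    and "\<And>\<theta> x y. \<theta> \<in> space \<Lambda> \<Longrightarrow> (\<And>i. x $ i \<le> y $ i) \<Longrightarrow> s \<theta> x \<le> s \<theta> y"
    and "integrable \<Lambda> (\<lambda>\<theta>. \<bar>s \<theta> 0\<bar>)"
    and "\<And>x y. integrable \<Lambda> (\<lambda>\<theta>. \<bar>s \<theta> x - s \<theta> y\<bar>)"
    and "\<And>x y. (LINT \<theta>|\<Lambda>. \<bar>s \<theta> x - s \<theta> y\<bar>) \<le> L * norm_l1 (x - y)"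
    and "0 \<le> \<gamma>" and "\<gamma> \<le> 1"
  shows "D_score D \<Lambda> s \<gamma> P Q = (1 - \<gamma>) * L_star D \<Lambda> s P Q - \<gamma> * Delta_score D \<Lambda> s P Q
    \<and> (1 - \<gamma>) * L_star D \<Lambda> s P Q - \<gamma> * Delta_score D \<Lambda> s P Q
        = (1 - \<gamma>) / 2 * W_score D \<Lambda> s P Q - (1 + \<gamma>) / 2 * Delta_score D \<Lambda> s P Q
    \<and> (\<exists>\<kappa>. attains_optimal_cost D (score_dist \<Lambda> s) P Q \<kappa>)
    \<and> (\<exists>\<kappa>. attains_optimal_cost D (score_loss \<Lambda> s) P Q \<kappa>)
    \<and> (\<exists>\<kappa>. attains_optimal_cost D (net_loss \<Lambda> s \<gamma>) P Q \<kappa>)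
    \<and> (\<gamma> < 1 \<longrightarrow> (\<forall>\<kappa>. attains_optimal_cost D (net_loss \<Lambda> s \<gamma>) P Q \<kappa>
                       \<longleftrightarrow> attains_optimal_cost D (score_dist \<Lambda> s) P Q \<kappa>))"
proof -
  interpret borel_prob_pair P Q
    using assms by (simp add: borel_prob_pair_def borel_prob_pair_axioms_def)
  let ?d = "score_dist \<Lambda> s" and ?S = "agg_score \<Lambda> s" and ?\<Delta> = "Delta_score D \<Lambda> s P Q"
  have s_meas: "(\<lambda>\<theta>. s \<theta> x) \<in> borel_measurable \<Lambda>" for x
    using measurable_compose[OF measurable_Pair2'[of x borel \<Lambda>] assms(12)] by simp
  have int_s: "integrable \<Lambda> (\<lambda>\<theta>. s \<theta> x)" for x
  proof (rule Bochner_Integration.integrable_bound)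
    show "integrable \<Lambda> (\<lambda>\<theta>. \<bar>s \<theta> x - s \<theta> 0\<bar> + \<bar>s \<theta> 0\<bar>)"
      using assms(14,15) by simp
  qed (auto intro: s_meas)
  have lip: "?d x y \<le> L * norm_l1 (x - y)" for x y
    unfolding score_dist_def by (rule assms(16))
  have triangle: "?d x y \<le> ?d x z + ?d z y" for x y z
    by (rule score_dist_triangle[OF int_s])
  have S_diff: "\<bar>?S x - ?S y\<bar> \<le> ?d x y" for x y
    by (rule agg_score_diff_le[OF int_s])
  have loss_eq: "score_loss \<Lambda> s x y = (?d x y + ?S x - ?S y) / 2" for x y
    by (rule score_loss_eq[OF int_s])
  have diag: "norm_l1 (0 :: real ^ 'd) = 0" by (simp add: norm_l1_def)
  have "continuous_on UNIV ?S"
  proof (rule continuous_on_dominated_increments)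
    show "\<bar>?S x - ?S y\<bar> \<le> L * norm_l1 (x - y)" for x y
      using S_diff[of x y] lip[of x y] by linarith
    show "continuous_on UNIV (\<lambda>x. L * norm_l1 (x - y))" for y :: "real ^ 'd"
      by (intro continuous_intros continuous_on_compose2[OF continuous_norm_l1[of UNIV]]) auto
  qed (simp add: diag)
  then have S_meas [measurable]: "?S \<in> borel_measurable borel"
    by (rule borel_measurable_continuous_onI)
  have cont: "continuous_on UNIV (\<lambda>z. ?d (fst z) (snd z))"
  proof (rule continuous_on_dominated_increments)
    \<comment> \<open>Moving one coordinate at a time changes \<open>?d\<close> by at most the
      distance moved; two triangle inequalities are used for each sign.\<close>
    show "\<bar>?d (fst z) (snd z) - ?d (fst w) (snd w)\<bar>
        \<le> L * norm_l1 (fst z - fst w) + L * norm_l1 (snd z - snd w)" for z w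
      using triangle[of "fst z" "snd z" "fst w"]
        triangle[of "fst w" "snd z" "snd w"]
        triangle[of "fst w" "snd w" "fst z"]
        triangle[of "fst z" "snd w" "snd z"]
        lip[of "fst z" "fst w"] lip[of "snd z" "snd w"]
        score_dist_commute[of \<Lambda> s "fst z" "fst w"] score_dist_commute[of \<Lambda> s "snd z" "snd w"]
      by linarith
    show "continuous_on UNIV (\<lambda>z. L * norm_l1 (fst z - fst w) + L * norm_l1 (snd z - snd w))"
      for w :: "(real ^ 'd) \<times> (real ^ 'd)"
      by (intro continuous_intros continuous_on_compose2[OF continuous_norm_l1[of UNIV]]) auto
  qed (simp add: diag)
  then have d_meas [measurable]: "(\<lambda>z. ?d (fst z) (snd z)) \<in> borel_measurable borel"
    by (rule borel_measurable_continuous_onI)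
  have AE_D: "AE x in P. x \<in> D" "AE x in Q. x \<in> D"
    using assms P.AE_in_set_eq_1 Q.AE_in_set_eq_1 by auto
  have \<Delta>_eq: "?\<Delta> = (\<integral>x. ?S x \<partial>Q) - (\<integral>x. ?S x \<partial>P)"
    unfolding Delta_score_def using AE_D assms(1) S_meas
    by (subst (1 2) set_integral_AE_eq) (auto simp: sets_P sets_Q cong: measurable_cong_sets)
  \<comment> \<open>\<open>?S\<close> grows at most linearly in \<open>norm_l1\<close>, so a finite
    first moment makes it integrable.\<close>
  have S_int_aux: "integrable M ?S"
    if "prob_space M" "sets M = sets borel" "integrable M norm_l1" for M
  proof -
    interpret M: prob_space M by fact
    show ?thesis
    proof (rule Bochner_Integration.integrable_bound)
      show "integrable M (\<lambda>x. \<bar>?S 0\<bar> + L * norm_l1 x)" using that(3) by simp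
      show "?S \<in> borel_measurable M" using S_meas that(2) by (simp cong: measurable_cong_sets)
      have "\<bar>?S x\<bar> \<le> \<bar>?S 0\<bar> + L * norm_l1 x" for x
        using S_diff[of x 0] lip[of x 0] by simp
      then show "AE x in M. norm (?S x) \<le> norm (\<bar>?S 0\<bar> + L * norm_l1 x)"
        by (intro AE_I2) (smt (verit) real_norm_def)
    qed
  qed
  have S_int: "integrable P ?S" "integrable Q ?S"
    using assms by (auto intro: S_int_aux)
  \<comment> \<open>The parameter \<open>g\<close> stays free: \<open>g = \<gamma>\<close> is the
    net loss and \<open>g = 0\<close> the score loss.\<close>
  have costs: "integrable \<kappa> (\<lambda>z. ?d (fst z) (snd z))"
    "transport_cost D ?d \<kappa> = (\<integral>z. ?d (fst z) (snd z) \<partial>\<kappa>)"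
    "transport_cost D (net_loss \<Lambda> s g) \<kappa> = (1 - g) / 2 * transport_cost D ?d \<kappa> - (1 + g) / 2 * ?\<Delta>"
    if \<kappa>: "\<kappa> \<in> couplings P Q" for \<kappa> g
  proof -
    interpret \<kappa>: prob_space \<kappa> by (rule prob_space_coupling[OF \<kappa>])
    note [measurable_cong] = sets_coupling[OF \<kappa>]
    note fst = integrable_coupling_fst[OF \<kappa>] and snd = integrable_coupling_snd[OF \<kappa>]
    have D_sets: "D \<times> D \<in> sets \<kappa>"
      using assms(1) by (simp add: sets_coupling[OF \<kappa>] borel_prod[symmetric])
    have "AE z in \<kappa>. fst z \<in> D"
      using AE_D(1) AE_distrD[OF measurable_fst_coupling[OF \<kappa>], of "\<lambda>x. x \<in> D"]
      unfolding distr_fst_coupling[OF \<kappa>] by blast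
    moreover have "AE z in \<kappa>. snd z \<in> D"
      using AE_D(2) AE_distrD[OF measurable_snd_coupling[OF \<kappa>], of "\<lambda>x. x \<in> D"]
      unfolding distr_snd_coupling[OF \<kappa>] by blast
    ultimately have AE_DD: "AE z in \<kappa>. z \<in> D \<times> D"
      by eventually_elim (auto simp: mem_Times_iff)
    have cost_eq: "transport_cost D c \<kappa> = (\<integral>z. c (fst z) (snd z) \<partial>\<kappa>)"
      if "(\<lambda>z. c (fst z) (snd z)) \<in> borel_measurable \<kappa>" for c
      unfolding transport_cost_def by (rule set_integral_AE_eq[OF AE_DD D_sets that])
    show int_d: "integrable \<kappa> (\<lambda>z. ?d (fst z) (snd z))"
    proof (rule Bochner_Integration.integrable_bound)
      \<comment> \<open>The sign of \<open>L\<close> is not part of the assumptions, so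
        \<open>\<bar>L\<bar>\<close> is used when \<open>norm_l1 (x - y)\<close> is
        enlarged.\<close>
      show "integrable \<kappa> (\<lambda>z. \<bar>L\<bar> * (norm_l1 (fst z) + norm_l1 (snd z)))"
        using fst[OF assms(6)] snd[OF assms(10)] by simp
      have "?d x y \<le> \<bar>L\<bar> * (norm_l1 x + norm_l1 y)" for x y
      proof -
        have "L * norm_l1 (x - y) \<le> \<bar>L\<bar> * (norm_l1 x + norm_l1 y)"
          by (intro mult_mono norm_l1_diff_le norm_l1_nonneg) auto
        with lip[of x y] show ?thesis by linarith
      qed
      then show "AE z in \<kappa>. norm (?d (fst z) (snd z)) \<le> norm (\<bar>L\<bar> * (norm_l1 (fst z) + norm_l1 (snd z)))"
        by (intro AE_I2) (simp add: score_dist_nonneg norm_l1_nonneg)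
    qed measurable
    show cost_d: "transport_cost D ?d \<kappa> = (\<integral>z. ?d (fst z) (snd z) \<partial>\<kappa>)"
      by (intro cost_eq) measurable
    \<comment> \<open>Exchanging the arguments keeps \<open>?d\<close> and reverses the sign of the
      \<open>?S\<close> difference, which gives the coefficients \<open>1 - g\<close> and
      \<open>1 + g\<close>.\<close>
    have net: "net_loss \<Lambda> s g x y = (1 - g) / 2 * ?d x y + (1 + g) / 2 * (?S x - ?S y)" for x y
      using score_dist_commute[of \<Lambda> s y x]
      by (simp add: net_loss_def loss_eq field_simps)
    have "integrable \<kappa> (\<lambda>z. net_loss \<Lambda> s g (fst z) (snd z))"
      unfolding net using int_d fst[OF S_int(1)] snd[OF S_int(2)] by simp
    then have "transport_cost D (net_loss \<Lambda> s g) \<kappa> = (\<integral>z. net_loss \<Lambda> s g (fst z) (snd z) \<partial>\<kappa>)"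
      by (intro cost_eq borel_measurable_integrable)
    also have "\<dots> = (1 - g) / 2 * (\<integral>z. ?d (fst z) (snd z) \<partial>\<kappa>)
        + (1 + g) / 2 * ((\<integral>z. ?S (fst z) \<partial>\<kappa>) - (\<integral>z. ?S (snd z) \<partial>\<kappa>))"
      unfolding net using int_d fst[OF S_int(1)] snd[OF S_int(2)] by simp
    \<comment> \<open>The first coordinate has law \<open>P\<close>, whereas
      \<open>?\<Delta>\<close> is the \<open>Q\<close> integral minus the \<open>P\<close> integral;
      hence the sign.\<close>
    also have "(\<integral>z. ?S (fst z) \<partial>\<kappa>) - (\<integral>z. ?S (snd z) \<partial>\<kappa>) = - ?\<Delta>"
      by (simp add: integral_coupling_fst[OF \<kappa> S_meas] integral_coupling_snd[OF \<kappa> S_meas] \<Delta>_eq)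
    finally show "transport_cost D (net_loss \<Lambda> s g) \<kappa> =
        (1 - g) / 2 * transport_cost D ?d \<kappa> - (1 + g) / 2 * ?\<Delta>"
      by (simp add: cost_d)
  qed
  have loss: "score_loss \<Lambda> s = net_loss \<Lambda> s 0"
    by (simp add: net_loss_def fun_eq_iff)
  obtain \<mu> where \<mu>: "\<mu> \<in> couplings P Q" and min: "\<And>\<kappa>. \<kappa> \<in> couplings P Q \<Longrightarrow>
      (\<integral>\<^sup>+z. ennreal (?d (fst z) (snd z)) \<partial>\<mu>) \<le> (\<integral>\<^sup>+z. ennreal (?d (fst z) (snd z)) \<partial>\<kappa>)"
  proof (rule optimal_coupling_exists)
    show "open {z. t < ?d (fst z) (snd z)}" for t
      by (intro open_Collect_less continuous_on_const cont)
  qed (auto simp: score_dist_nonneg)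
  \<comment> \<open>Integrability of \<open>?d\<close> under every coupling makes the extended costs
    finite, so the minimality of \<open>\<mu>\<close> carries over to real costs.\<close>
  have nn: "(\<integral>\<^sup>+z. ennreal (?d (fst z) (snd z)) \<partial>\<kappa>) = ennreal (transport_cost D ?d \<kappa>)"
    and cost_nonneg: "0 \<le> transport_cost D ?d \<kappa>" if "\<kappa> \<in> couplings P Q" for \<kappa>
    using costs(1,2)[OF that] by (simp_all add: nn_integral_eq_integral score_dist_nonneg)
  have min_d: "transport_cost D ?d \<mu> \<le> transport_cost D ?d \<kappa>" if "\<kappa> \<in> couplings P Q" for \<kappa>
    using min[OF that] by (simp add: nn \<mu> that cost_nonneg)
  have att_d: "attains_optimal_cost D ?d P Q \<mu>"
    using \<mu> min_d by (simp add: attains_optimal_cost_iff)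
  \<comment> \<open>The slope \<open>(1 - g) / 2\<close> is nonnegative, so \<open>\<mu>\<close>
    stays a minimiser, also in the degenerate case \<open>g = 1\<close>, where the cost is constant
    on couplings.\<close>
  have att_net: "attains_optimal_cost D (net_loss \<Lambda> s g) P Q \<mu>" if "g \<le> 1" for g
    using \<mu> that min_d by (auto simp: attains_optimal_cost_iff costs(3) intro!: mult_left_mono)
  have W: "W_score D \<Lambda> s P Q = transport_cost D ?d \<mu>"
    using att_d by (simp add: W_score_def attains_optimal_cost_def)
  have Dg: "optimal_cost D (net_loss \<Lambda> s g) P Q =
      (1 - g) / 2 * transport_cost D ?d \<mu> - (1 + g) / 2 * ?\<Delta>" if "g \<le> 1" for g
    using att_net[OF that] costs(3)[OF \<mu>, of g] by (simp add: attains_optimal_cost_def)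
  have Ls: "L_star D \<Lambda> s P Q = (transport_cost D ?d \<mu> - ?\<Delta>) / 2"
    using Dg[of 0] by (simp add: L_star_def loss diff_divide_distrib)
  \<comment> \<open>For \<open>\<gamma> < 1\<close> the slope is positive and can be cancelled from
    the inequalities between costs, so the minimisers coincide.\<close>
  have iff: "attains_optimal_cost D (net_loss \<Lambda> s \<gamma>) P Q \<kappa> \<longleftrightarrow> attains_optimal_cost D ?d P Q \<kappa>"
    if "\<gamma> < 1" for \<kappa>
    using that by (auto simp: attains_optimal_cost_iff costs(3))
  have "D_score D \<Lambda> s \<gamma> P Q = (1 - \<gamma>) * L_star D \<Lambda> s P Q - \<gamma> * ?\<Delta>"
    using Dg[OF \<open>\<gamma> \<le> 1\<close>] by (simp add: D_score_def Ls field_simps)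
  moreover have "(1 - \<gamma>) * L_star D \<Lambda> s P Q - \<gamma> * ?\<Delta> =
      (1 - \<gamma>) / 2 * W_score D \<Lambda> s P Q - (1 + \<gamma>) / 2 * ?\<Delta>"
    by (simp add: Ls W field_simps)
  ultimately show ?thesis
    using att_d att_net[OF \<open>\<gamma> \<le> 1\<close>] att_net[of 0] iff unfolding loss by auto
qed

end
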